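(* Let $U=U_q(\overline{\mathfrak{g}(1,1)})$ be the quantum extended Galilei algebra in $(1+1)$ dimensions (only its algebra structure is used), with generators $K,M,P,H$, and let $\mathcal{A}$ be the algebra with ordered monomial basis $v^m\mu^nx^pt^q$, paired with $U$, both as described in the context. Consider the character of the (abelian) subalgebra of $U$ generated by $\{M,K\}$ defined by $$K^mM^n\vdash 1=\alpha^m\beta^n,\qquad \alpha,\beta\in\mathbb{C}.$$ The carrier space $\mathbb{C}^\uparrow$ of the representation of $U$ induced by this character is constituted by the elements of $\mathcal{A}$ of the form $$e^{\alpha v}e^{\beta\mu}\,\phi(x,t),$$ with $\phi(x,t)$ a linear combination of the monomials $x^pt^q$, and $\mathbb{C}^\uparrow$ is isomorphic to the subspace generated by the elements $x^pt^q$. The action of the generators (written on $\phi$) is $$K\vdash\phi(x,t)=\Big[\alpha-\beta\,\bar{x}-\bar{t}\,\frac{\sinh(a\,\partial_x)}{a}\Big]\phi(x,t),\qquad M\vdash\phi(x,t)=\beta\,\phi(x,t),$$ $$P\vdash\phi(x,t)=\frac{\partial}{\partial x}\phi(x,t),\qquad H\vdash\phi(x,t)=\frac{\partial}{\partial t}\phi(x,t).$$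
   Context: **The algebra.** $a$ is the deformation parameter. $U=U_q(\overline{\mathfrak{g}(1,1)})$ is the associative unital algebra generated by $K,M,P,H$ whose only nonvanishing commutators among the generators are $$[P,K]=-M,\qquad [H,K]=-\frac{\sinh(aP)}{a}.$$ The ordered monomials $K^mM^nP^pH^q$, $m,n,p,q\in\mathbb{N}$ (with $0\in\mathbb{N}$), are used as a basis of $U$. **The dual space.** $\mathcal{A}$ is a unital associative algebra generated by four elements $v,\mu,x,t$, whose commutation relations are not specified; it is assumed that the ordered monomials $v^m\mu^nx^pt^q$ determine a basis of the linear space underlying $\mathcal{A}$, and that $U\times\mathcal{A}$ carries the nondegenerate bilinear form $$\langle K^mM^nP^pH^q,\ v^{m'}\mu^{n'}x^{p'}t^{q'}\rangle=m!\,n!\,p!\,q!\;\delta^m_{m'}\delta^n_{n'}\delta^p_{p'}\delta^q_{q'}.$$ Only the linear structure of $\mathcal{A}$ is used. Exponentials and hyperbolic functions stand for their usual power series, handled formally; no completion or topology is specified. **Operators.** $\bar{x}$ and $\bar{t}$ raise by one the exponent of $x$, respectively $t$, in an ordered monomial; $\partial_x=\partial/\partial x$ and $\partial/\partial t$ are the formal derivatives on ordered monomials, e.g. $\frac{\partial}{\partial x}(v^m\mu^nx^pt^q)=p\,v^m\mu^nx^{p-1}t^q$. **Induced representation.** For $f\in\mathcal{A}$ and $h_1\in U$ define $f\triangleleft h_1$ and $h_1\triangleright f$ by $$\langle h_2,\,f\triangleleft h_1\rangle=\langle h_1h_2,\,f\rangle,\qquad \langle h_2,\,h_1\triangleright f\rangle=\langle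 h_2h_1,\,f\rangle,\qquad \forall h_2\in U.$$ The carrier space $\mathbb{C}^\uparrow$ of the representation induced by the character is the space of $f\in\mathcal{A}$ satisfying the equivariance condition $f\triangleleft K=\alpha f$, $f\triangleleft M=\beta f$. The induced action $\vdash$ is the restriction of $\triangleright$ to $\mathbb{C}^\uparrow$, expressed on $\phi$ through $f=e^{\alpha v}e^{\beta\mu}\phi(x,t)$. *)

theory Defs
  imports
    "HOL-Computational_Algebra.Polynomial"
    "HOL-Computational_Algebra.Formal_Power_Series"
    "HOL-Library.Groups_Big_Fun"
    "HOL-Library.Function_Algebras"
    "HOL-Algebra.Ring"
begin

section \<open>The algebra U\<close>

text \<open>
  The relation for \<open>[H,K]\<close> involves the power series \<open>sinh(aP)/a\<close>, so \<open>U\<close> is taken to consist of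
  the ordered expressions \<open>\<Sum> c\<^sub>m\<^sub>n\<^sub>p\<^sub>q K\<^sup>m M\<^sup>n P\<^sup>p H\<^sup>q\<close> that are polynomial in \<open>K, M, H\<close> and formal power
  series in \<open>P\<close>. From the outside in, the type constructors below stand for \<open>K\<close>, \<open>M\<close>, \<open>H\<close>, \<open>P\<close>.
  The type class product of this type (written \<open>*\<close>) is the commutative product of the symbols;
  the product of \<open>U\<close> is \<open>umult\<close>.
\<close>

type_synonym U = "complex fps poly poly poly"

definition ucoeff :: "U \<Rightarrow> nat \<Rightarrow> nat \<Rightarrow> nat \<Rightarrow> nat \<Rightarrow> complex" where
  "ucoeff h m n p q = fps_nth (coeff (coeff (coeff h m) n) q) p"

definition uconst :: "complex \<Rightarrow> U" where "uconst c = [:[:[:fps_const c:]:]:]"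

definition uscale :: "complex \<Rightarrow> U \<Rightarrow> U" where "uscale c h = uconst c * h"

definition UK :: U where "UK = [:0, 1:]"
definition UM :: U where "UM = [:[:0, 1:]:]"
definition UH :: U where "UH = [:[:[:0, 1:]:]:]"
definition UP :: U where "UP = [:[:[:fps_X:]:]:]"

text \<open>The power series \<open>sinh(aX)/a\<close>.\<close>

definition sinh_series :: "complex \<Rightarrow> complex fps" where
  "sinh_series a = fps_const (1 / a) * (fps_const (1 / 2) * (fps_exp a - fps_exp (- a)))"

definition U_sinh :: "complex \<Rightarrow> U" where
  "U_sinh a = [:[:[:sinh_series a:]:]:]"

text \<open>
  Formal partial derivatives of ordered expressions with respect to \<open>P\<close> and \<open>H\<close>; the one with
  respect to \<open>K\<close> is \<open>pderiv\<close> itself.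
\<close>

definition dP :: "U \<Rightarrow> U" where "dP = map_poly (map_poly (map_poly fps_deriv))"
definition dH :: "U \<Rightarrow> U" where "dH = map_poly (map_poly pderiv)"

text \<open>
  The commutator relations say \<open>r K = K r + \<delta>(r)\<close> for every \<open>r\<close> in the commutative algebra of
  expressions in \<open>M, P, H\<close>, where \<open>\<delta> = - M \<partial>/\<partial>P - (sinh(aP)/a) \<partial>/\<partial>H\<close>. Hence
  \<open>r K\<^sup>j = \<Sum>\<^sub>l (j choose l) K\<^sup>j\<^sup>-\<^sup>l \<delta>\<^sup>l(r)\<close>, which is the product \<open>umult\<close> in terms of ordered expressions.
\<close>

definition udelta :: "complex \<Rightarrow> U \<Rightarrow> U" where
  "udelta a h = - (UM * dP h + U_sinh a * dH h)"

definition umult :: "complex \<Rightarrow> U \<Rightarrow> U \<Rightarrow> U" where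
  "umult a g h = (\<Sum>l\<le>degree h. uscale (1 / fact l) ((udelta a ^^ l) g * (pderiv ^^ l) h))"

definition galilei :: "complex \<Rightarrow> U ring" where
  "galilei a = \<lparr>carrier = UNIV, mult = umult a, one = 1, zero = 0, add = (+)\<rparr>"

definition umonom :: "complex \<Rightarrow> nat \<Rightarrow> nat \<Rightarrow> nat \<Rightarrow> nat \<Rightarrow> U" where
  "umonom a m n p q =
     UK [^]\<^bsub>galilei a\<^esub> m \<otimes>\<^bsub>galilei a\<^esub> UM [^]\<^bsub>galilei a\<^esub> n \<otimes>\<^bsub>galilei a\<^esub>
     UP [^]\<^bsub>galilei a\<^esub> p \<otimes>\<^bsub>galilei a\<^esub> UH [^]\<^bsub>galilei a\<^esub> q"


subsection \<open>U is an algebra with the required relations and ordered monomials\<close>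

lemma map_poly_add_gen:
  assumes "\<And>x y. d (x + y) = d x + d y" "d 0 = 0"
  shows "map_poly d (p + q) = map_poly d p + map_poly d q"
  by (rule poly_eqI) (simp add: coeff_map_poly assms)

lemma map_poly_leibniz:
  fixes d :: "'a::comm_ring_1 \<Rightarrow> 'a"
  assumes add: "\<And>x y. d (x + y) = d x + d y"
    and mul: "\<And>x y. d (x * y) = d x * y + x * d y"
  shows "map_poly d (p * q) = map_poly d p * q + p * map_poly d q"
proof (rule poly_eqI)
  fix n
  have z: "d 0 = 0" using add[of 0 0] by (metis add.right_neutral add_left_cancel)
  have s: "d (sum f A) = (\<Sum>x\<in>A. d (f x))" for f :: "nat \<Rightarrow> 'a" and A
    by (induction A rule: infinite_finite_induct) (auto simp: z add)
  show "coeff (map_poly d (p * q)) n = coeff (map_poly d p * q + p * map_poly d q) n"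
    by (simp add: coeff_map_poly z coeff_mult s mul sum.distrib)
qed

lemma map_poly_pderiv_commute:
  fixes d :: "'a::idom \<Rightarrow> 'a"
  assumes add: "\<And>x y. d (x + y) = d x + d y"
  shows "pderiv (map_poly d p) = map_poly d (pderiv p)"
proof (rule poly_eqI)
  fix n
  have z: "d 0 = 0" using add[of 0 0] by (metis add.right_neutral add_left_cancel)
  have k: "d (of_nat k * x) = of_nat k * d x" for k :: nat and x
    by (induction k) (auto simp: z add algebra_simps)
  show "coeff (pderiv (map_poly d p)) n = coeff (map_poly d (pderiv p)) n"
    using k[of "Suc n"] by (simp add: coeff_map_poly z coeff_pderiv)
qed

lemma pderiv_mult': "pderiv (x * y) = pderiv x * y + x * pderiv (y::'a::idom poly)"
  by (simp add: pderiv_mult algebra_simps)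

lemma dP_add: "dP (x + y) = dP x + dP y"
  unfolding dP_def by (intro map_poly_add_gen) (auto intro: map_poly_add_gen)

lemma dH_add: "dH (x + y) = dH x + dH y"
  unfolding dH_def by (intro map_poly_add_gen) (auto intro: map_poly_add_gen simp: pderiv_add)

lemma dP_mult: "dP (x * y) = dP x * y + x * dP y"
  unfolding dP_def by (intro map_poly_leibniz map_poly_add_gen) auto

lemma dH_mult: "dH (x * y) = dH x * y + x * dH y"
  unfolding dH_def by (intro map_poly_leibniz map_poly_add_gen) (auto simp: pderiv_add pderiv_mult')

lemma pderiv_dP: "pderiv (dP x) = dP (pderiv x)"
  unfolding dP_def by (intro map_poly_pderiv_commute map_poly_add_gen) auto

lemma pderiv_dH: "pderiv (dH x) = dH (pderiv x)"
  unfolding dH_def by (intro map_poly_pderiv_commute map_poly_add_gen) (auto simp: pderiv_add)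

lemma udelta_add: "udelta a (x + y) = udelta a x + udelta a y"
  by (simp add: udelta_def dP_add dH_add algebra_simps)

lemma udelta_mult: "udelta a (x * y) = udelta a x * y + x * udelta a y"
  by (simp add: udelta_def dP_mult dH_mult algebra_simps)

lemma udelta_const: "udelta a (uconst c) = 0"
  by (simp add: udelta_def uconst_def dP_def dH_def map_poly_pCons)

lemma udelta_uscale: "udelta a (uscale c x) = uscale c (udelta a x)"
  by (simp add: uscale_def udelta_mult udelta_const)

lemma pderiv_udelta: "pderiv (udelta a x) = udelta a (pderiv x)"
proof -
  have "pderiv UM = 0" "pderiv (U_sinh a) = 0" by (simp_all add: UM_def U_sinh_def pderiv_pCons)
  then show ?thesis
    unfolding udelta_def by (simp only: pderiv_add pderiv_minus pderiv_mult' pderiv_dP pderiv_dH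
        mult_zero_left add_0_left)
qed

lemma udelta_0 [simp]: "udelta a 0 = 0"
  by (simp add: udelta_def dP_def dH_def)

lemma udelta_pow_0 [simp]: "(udelta a ^^ l) 0 = 0"
  by (induction l) auto

lemma uscale_0 [simp]: "uscale c 0 = 0"
  by (simp add: uscale_def)

lemma uscale_1 [simp]: "uscale 1 h = h"
  by (simp add: uscale_def uconst_def one_pCons[symmetric])

lemma uscale_uscale: "uscale c (uscale d x) = uscale (c * d) x"
proof -
  have "uconst (c * d) = uconst c * uconst d"
    by (simp add: uconst_def flip: fps_const_mult)
  then show ?thesis by (simp add: uscale_def mult.assoc)
qed

lemma uscale_add: "uscale c (x + y) = uscale c x + uscale c y"
  by (simp add: uscale_def algebra_simps)

lemma uscale_sum: "uscale c (sum f A) = (\<Sum>x\<in>A. uscale c (f x))"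
  by (simp only: uscale_def sum_distrib_left)

lemma uscale_mult_left: "uscale c x * y = uscale c (x * y)"
  by (simp only: uscale_def mult.assoc)

lemma uscale_mult_right: "x * uscale c y = uscale c (x * y)"
  by (simp only: uscale_def mult.left_commute)

lemma uscale_of_nat: "of_nat k * x = uscale (of_nat k) x"
proof -
  have "uconst (of_nat k) = of_nat k"
    by (simp add: uconst_def of_nat_poly fps_of_nat)
  then show ?thesis by (simp add: uscale_def)
qed

lemma pderiv_uscale: "pderiv (uscale c x) = uscale c (pderiv x)"
  by (simp add: uscale_def uconst_def pderiv_smult)

lemma pow_uscale:
  "(udelta a ^^ l) (uscale c x) = uscale c ((udelta a ^^ l) x)"
  "(pderiv ^^ l) (uscale c x) = uscale c ((pderiv ^^ l) x)"
  by (induction l) (simp_all add: udelta_uscale pderiv_uscale)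

lemma pow_udelta_sum: "(udelta a ^^ l) (sum f A) = (\<Sum>x\<in>A. (udelta a ^^ l) (f x))"
proof -
  have add: "(udelta a ^^ l) (x + y) = (udelta a ^^ l) x + (udelta a ^^ l) y" for x y
    by (induction l) (simp_all add: udelta_add)
  show ?thesis by (induction A rule: infinite_finite_induct) (simp_all add: add)
qed

lemma pow_commute: "(pderiv ^^ k) ((udelta a ^^ l) x) = (udelta a ^^ l) ((pderiv ^^ k) x)"
proof -
  have "pderiv ((udelta a ^^ l) x) = (udelta a ^^ l) (pderiv x)" for x
    by (induction l) (simp_all add: pderiv_udelta)
  then show ?thesis by (induction k) simp_all
qed

lemma higher_pderiv_eq_0: "degree (x :: U) < l \<Longrightarrow> (pderiv ^^ l) x = 0"
  by (intro poly_eqI) (simp add: coeff_higher_pderiv coeff_eq_0)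

lemma leibniz_pow:
  fixes d :: "U \<Rightarrow> U"
  assumes add: "\<And>x y. d (x + y) = d x + d y"
    and mul: "\<And>x y. d (x * y) = d x * y + x * d y"
  shows "(d ^^ n) (x * y) =
    (\<Sum>i\<le>n. of_nat (n choose i) * ((d ^^ i) x * (d ^^ (n - i)) y))"
proof -
  have z: "d 0 = 0" using add[of 0 0] by (metis add.right_neutral add_left_cancel)
  have k: "d (of_nat k * x) = of_nat k * d x" for k :: nat and x
    by (induction k) (auto simp: z add algebra_simps)
  have s: "d (sum f A) = (\<Sum>x\<in>A. d (f x))" for f :: "nat \<Rightarrow> U" and A
    by (induction A rule: infinite_finite_induct) (auto simp: z add)
  show ?thesis
  proof (induction n)
    case 0
    show ?case by simp
  next
    case (Suc n)
    let ?t = "\<lambda>n i. (d ^^ i) x * (d ^^ (n - i)) y"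
    have "(d ^^ Suc n) (x * y) = (\<Sum>i\<le>n. of_nat (n choose i) * ?t (Suc n) (Suc i))
        + (\<Sum>i\<le>n. of_nat (n choose i) * ?t (Suc n) i)"
    proof -
      have "(d ^^ Suc n) (x * y) = (\<Sum>i\<le>n. of_nat (n choose i) * d (?t n i))"
        by (simp only: funpow.simps comp_apply Suc s k)
      then show ?thesis
        by (simp add: mul sum.distrib algebra_simps Suc_diff_le)
    qed
    also have "(\<Sum>i\<le>n. of_nat (n choose i) * ?t (Suc n) i)
        = (\<Sum>i\<le>Suc n. of_nat (n choose i) * ?t (Suc n) i)"
      by (simp add: binomial_eq_0)
    also have "\<dots> = ?t (Suc n) 0 + (\<Sum>i\<le>n. of_nat (n choose Suc i) * ?t (Suc n) (Suc i))"
      by (subst sum.atMost_Suc_shift) simp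
    also have "(\<Sum>i\<le>n. of_nat (n choose i) * ?t (Suc n) (Suc i)) + \<dots>
        = ?t (Suc n) 0 + (\<Sum>i\<le>n. of_nat (Suc n choose Suc i) * ?t (Suc n) (Suc i))"
      by (simp add: sum.distrib algebra_simps)
    also have "\<dots> = (\<Sum>i\<le>Suc n. of_nat (Suc n choose i) * ?t (Suc n) i)"
      by (subst sum.atMost_Suc_shift) simp
    finally show ?case .
  qed
qed

lemma leibniz_pow_fact:
  fixes d :: "U \<Rightarrow> U"
  assumes add: "\<And>x y. d (x + y) = d x + d y"
    and mul: "\<And>x y. d (x * y) = d x * y + x * d y"
  shows "uscale (1 / fact n) ((d ^^ n) (x * y)) =
    (\<Sum>i\<le>n. uscale (1 / (fact i * fact (n - i))) ((d ^^ i) x * (d ^^ (n - i)) y))"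
  unfolding leibniz_pow[OF assms] uscale_sum
  by (intro sum.cong refl) (simp add: uscale_of_nat uscale_uscale binomial_fact)

lemma umult_eq:
  assumes "degree h < N"
  shows "umult a g h = (\<Sum>l<N. uscale (1 / fact l) ((udelta a ^^ l) g * (pderiv ^^ l) h))"
proof -
  have "(\<Sum>l<N. uscale (1 / fact l) ((udelta a ^^ l) g * (pderiv ^^ l) h))
     = (\<Sum>l\<le>degree h. uscale (1 / fact l) ((udelta a ^^ l) g * (pderiv ^^ l) h))"
    using assms by (intro sum.mono_neutral_right) (auto simp: higher_pderiv_eq_0)
  then show ?thesis by (simp add: umult_def)
qed

lemma sum_triangle:
  fixes F :: "nat \<Rightarrow> nat \<Rightarrow> 'a::comm_monoid_add"
  assumes "\<And>i j. i \<ge> N \<or> j \<ge> N \<Longrightarrow> F i j = 0"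
  shows "(\<Sum>n<2*N. \<Sum>i\<le>n. F i (n - i)) = (\<Sum>i<N. \<Sum>j<N. F i j)"
proof -
  have "(\<Sum>n<2*N. \<Sum>i\<le>n. F i (n - i)) = (\<Sum>(n,i)\<in>Sigma {..<2*N} (\<lambda>n. {..n}). F i (n - i))"
    by (rule sum.Sigma) auto
  also have "\<dots> = (\<Sum>(i,j)\<in>{(i,j). i + j < 2*N}. F i j)"
    by (rule sum.reindex_bij_witness[of _ "\<lambda>(i,j). (i+j,i)" "\<lambda>(n,i). (i,n-i)"]) auto
  also have "\<dots> = (\<Sum>(i,j)\<in>{..<N} \<times> {..<N}. F i j)"
  proof (rule sum.mono_neutral_right)
    have "{(i,j). i + j < 2*N} \<subseteq> {..<2*N} \<times> {..<2*N}" by auto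
    then show "finite {(i,j). i + j < 2*N}" by (rule finite_subset) auto
    show "\<forall>i\<in>{(i,j). i + j < 2*N} - {..<N} \<times> {..<N}. (case i of (i, j) \<Rightarrow> F i j) = 0"
      by (clarsimp) (metis assms not_le)
  qed auto
  finally show ?thesis by (simp add: sum.cartesian_product)
qed

lemma umult_assoc: "umult a (umult a f g) h = umult a f (umult a g h)"
proof -
  define d where "d = udelta a"
  define e where "e = (pderiv :: U \<Rightarrow> U)"
  obtain N where N: "degree g < N" "degree h < N" "degree (umult a g h) < 2 * N"
    using that[of "Suc (max (degree g) (max (degree h) (degree (umult a g h))))"] by auto
  define T where "T i j l = uscale (1 / (fact i * fact j * fact l))
      ((d ^^ (i + l)) f * ((d ^^ j) ((e ^^ l) g) * (e ^^ (i + j)) h))" for i j l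
  have e0: "(e ^^ l) g = 0" "(e ^^ l) h = 0" if "l \<ge> N" for l
    using N that by (simp_all add: e_def higher_pderiv_eq_0)
  have T0: "T i j l = 0" if "i \<ge> N \<or> j \<ge> N \<or> l \<ge> N" for i j l
    using e0(1)[of l] e0(2)[of "i + j"] that by (cases "l \<ge> N") (auto simp: T_def d_def)
  have dl: "uscale (1 / fact n) ((d ^^ n) (x * y)) =
    (\<Sum>i\<le>n. uscale (1 / (fact i * fact (n - i))) ((d ^^ i) x * (d ^^ (n - i)) y))" for n x y
    unfolding d_def by (rule leibniz_pow_fact) (simp_all add: udelta_add udelta_mult)
  have el: "uscale (1 / fact n) ((e ^^ n) (x * y)) =
    (\<Sum>i\<le>n. uscale (1 / (fact i * fact (n - i))) ((e ^^ i) x * (e ^^ (n - i)) y))" for n x y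
    unfolding e_def by (rule leibniz_pow_fact) (simp_all add: pderiv_add pderiv_mult')
  have "umult a (umult a f g) h
      = (\<Sum>n<2*N. uscale (1 / fact n) ((d ^^ n) (umult a f g) * (e ^^ n) h))"
    using N unfolding d_def e_def by (intro umult_eq) auto
  also have "\<dots> = (\<Sum>n<2*N. \<Sum>l<N. uscale (1 / fact l)
      (uscale (1 / fact n) ((d ^^ n) ((d ^^ l) f * (e ^^ l) g)) * (e ^^ n) h))"
    unfolding umult_eq[OF N(1)] d_def e_def pow_udelta_sum pow_uscale sum_distrib_right uscale_sum
      uscale_mult_left uscale_uscale
    by (intro sum.cong refl) (simp add: mult.commute)
  also have "\<dots> = (\<Sum>n<2*N. \<Sum>l<N. \<Sum>i\<le>n. T i (n - i) l)"
    unfolding dl sum_distrib_right uscale_sum uscale_mult_left uscale_uscale T_def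
    by (intro sum.cong refl) (simp add: funpow_add mult_ac)
  also have "\<dots> = (\<Sum>l<N. \<Sum>n<2*N. \<Sum>i\<le>n. T i (n - i) l)"
    by (rule sum.swap)
  also have "\<dots> = (\<Sum>l<N. \<Sum>i<N. \<Sum>j<N. T i j l)"
    by (intro sum.cong refl sum_triangle) (use T0 in auto)
  finally have L: "umult a (umult a f g) h = (\<Sum>l<N. \<Sum>i<N. \<Sum>j<N. T i j l)" .
  have ds: "(e ^^ n) (sum F A) = (\<Sum>x\<in>A. (e ^^ n) (F x))" for n F and A :: "nat set"
    unfolding e_def by (rule higher_pderiv_sum)
  have "umult a f (umult a g h)
      = (\<Sum>n<2*N. uscale (1 / fact n) ((d ^^ n) f * (e ^^ n) (umult a g h)))"
    using N unfolding d_def e_def by (intro umult_eq) auto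
  also have "\<dots> = (\<Sum>n<2*N. \<Sum>j<N. uscale (1 / fact j)
      ((d ^^ n) f * uscale (1 / fact n) ((e ^^ n) ((d ^^ j) g * (e ^^ j) h))))"
    unfolding umult_eq[OF N(2)] d_def e_def higher_pderiv_sum pow_uscale sum_distrib_left uscale_sum
      uscale_mult_right uscale_uscale
    by (intro sum.cong refl) (simp add: mult.commute)
  also have "\<dots> = (\<Sum>n<2*N. \<Sum>j<N. \<Sum>l\<le>n. T (n - l) j l)"
    unfolding el sum_distrib_left uscale_sum uscale_mult_right uscale_uscale T_def
    by (intro sum.cong refl)
       (simp add: d_def e_def pow_commute funpow_add mult_ac
          del: Nat.add_diff_assoc2 Nat.diff_add_assoc2)
  also have "\<dots> = (\<Sum>j<N. \<Sum>n<2*N. \<Sum>l\<le>n. T (n - l) j l)"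
    by (rule sum.swap)
  also have "\<dots> = (\<Sum>j<N. \<Sum>l<N. \<Sum>i<N. T i j l)"
    by (intro sum.cong refl sum_triangle) (use T0 in auto)
  also have "\<dots> = (\<Sum>l<N. \<Sum>j<N. \<Sum>i<N. T i j l)"
    by (rule sum.swap)
  also have "\<dots> = (\<Sum>l<N. \<Sum>i<N. \<Sum>j<N. T i j l)"
    by (intro sum.cong refl sum.swap)
  finally show ?thesis using L by simp
qed

lemma umult_const_right: "degree h = 0 \<Longrightarrow> umult a g h = g * h"
  by (simp add: umult_def)

lemma umult_K_right: "umult a g UK = UK * g + udelta a g"
  by (simp add: umult_def UK_def algebra_simps pderiv_pCons)

lemma umult_delta_0:
  assumes "udelta a g = 0"
  shows "umult a g h = g * h"
proof -
  have "(udelta a ^^ l) g = (if l = 0 then g else 0)" for l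
    using assms by (cases l) (simp_all add: funpow_Suc_right del: funpow.simps)
  then show ?thesis
    unfolding umult_def by (subst sum.remove[of _ 0]) auto
qed

lemma galilei_ring: "ring (galilei a)"
proof (rule ringI)
  show "abelian_group (galilei a)"
  proof (rule abelian_groupI)
    fix x assume "x \<in> carrier (galilei a)"
    show "\<exists>y\<in>carrier (galilei a). y \<oplus>\<^bsub>galilei a\<^esub> x = \<zero>\<^bsub>galilei a\<^esub>"
      by (rule bexI[of _ "- x"]) (simp_all add: galilei_def)
  qed (simp_all add: galilei_def add_ac)
  show "monoid (galilei a)"
    by (rule monoidI)
       (simp_all add: galilei_def umult_assoc umult_const_right umult_delta_0
          udelta_const[of a 1, unfolded uconst_def, simplified, folded one_pCons])
next
  fix f g h :: U
  show "(f \<oplus>\<^bsub>galilei a\<^esub> g) \<otimes>\<^bsub>galilei a\<^esub> h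
      = f \<otimes>\<^bsub>galilei a\<^esub> h \<oplus>\<^bsub>galilei a\<^esub> g \<otimes>\<^bsub>galilei a\<^esub> h"
  proof -
    have add: "(udelta a ^^ l) (x + y) = (udelta a ^^ l) x + (udelta a ^^ l) y" for l x y
      by (induction l) (simp_all add: udelta_add)
    show ?thesis
      by (simp add: galilei_def umult_def add distrib_right uscale_add sum.distrib)
  qed
  show "h \<otimes>\<^bsub>galilei a\<^esub> (f \<oplus>\<^bsub>galilei a\<^esub> g)
      = h \<otimes>\<^bsub>galilei a\<^esub> f \<oplus>\<^bsub>galilei a\<^esub> h \<otimes>\<^bsub>galilei a\<^esub> g"
  proof -
    obtain N where N: "degree f < N" "degree g < N" "degree (f + g) < N"
      using that[of "Suc (max (degree f) (max (degree g) (degree (f + g))))"] by auto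
    show ?thesis
      unfolding galilei_def
      by (simp add: umult_eq[OF N(1)] umult_eq[OF N(2)] umult_eq[OF N(3)]
          higher_pderiv_add distrib_left uscale_add sum.distrib)
  qed
qed

lemma galilei_scale:
  "umult a (uscale c g) h = uscale c (umult a g h)"
  "umult a g (uscale c h) = uscale c (umult a g h)"
proof -
  show "umult a (uscale c g) h = uscale c (umult a g h)"
    unfolding umult_def uscale_sum pow_uscale uscale_mult_left uscale_uscale
    by (simp add: mult.commute)
  obtain N where N: "degree h < N" "degree (uscale c h) < N"
    using that[of "Suc (max (degree h) (degree (uscale c h)))"] by auto
  show "umult a g (uscale c h) = uscale c (umult a g h)"
    by (simp add: umult_eq[OF N(1)] umult_eq[OF N(2)] uscale_sum pow_uscale uscale_mult_right
          uscale_uscale mult.commute)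
qed

lemma udelta_generators:
  "udelta a UK = 0" "udelta a UM = 0" "udelta a UP = - UM" "udelta a UH = - U_sinh a"
  by (simp_all add: udelta_def dP_def dH_def UK_def UM_def UP_def UH_def map_poly_pCons
        U_sinh_def pderiv_pCons one_pCons)

lemma galilei_relations:
  "umult a UP UK - umult a UK UP = - UM"
  "umult a UH UK - umult a UK UH = - U_sinh a"
  "umult a UM UK = umult a UK UM"
  "umult a UM UP = umult a UP UM"
  "umult a UM UH = umult a UH UM"
  "umult a UP UH = umult a UH UP"
proof -
  have deg: "degree UM = 0" "degree UP = 0" "degree UH = 0"
    by (simp_all add: UM_def UP_def UH_def)
  note s = umult_K_right umult_const_right[OF deg(1)] umult_const_right[OF deg(2)]
    umult_const_right[OF deg(3)] udelta_generators
  show "umult a UP UK - umult a UK UP = - UM" by (simp add: s)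
  show "umult a UH UK - umult a UK UH = - U_sinh a" by (simp add: s)
  show "umult a UM UK = umult a UK UM" by (simp add: s mult.commute)
  show "umult a UM UP = umult a UP UM" by (simp add: s mult.commute)
  show "umult a UM UH = umult a UH UM" by (simp add: s mult.commute)
  show "umult a UP UH = umult a UH UP" by (simp add: s mult.commute)
qed

lemma galilei_pow_const:
  assumes "degree x = 0" shows "x [^]\<^bsub>galilei a\<^esub> (n::nat) = x ^ n"
  by (induction n) (simp_all add: galilei_def nat_pow_def umult_const_right[OF assms] mult.commute)

lemma udelta_pow_K: "udelta a (UK ^ n) = 0"
proof (induction n)
  case 0
  show ?case using udelta_const[of a 1] by (simp add: uconst_def flip: one_pCons)
qed (simp add: udelta_mult udelta_generators)

lemma galilei_pow_K: "UK [^]\<^bsub>galilei a\<^esub> (n::nat) = UK ^ n"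
proof (induction n)
  case (Suc n)
  then have "UK [^]\<^bsub>galilei a\<^esub> Suc n = umult a (UK ^ n) UK"
    by (simp add: galilei_def nat_pow_def)
  then show ?case by (simp add: umult_delta_0[OF udelta_pow_K] mult.commute)
qed (simp add: galilei_def nat_pow_def)

lemma umonom_eq: "umonom a m n p q = monom (monom (monom (fps_X ^ p) q) n) m"
proof -
  have deg: "degree UM = 0" "degree UP = 0" "degree UH = 0"
    by (simp_all add: UM_def UP_def UH_def)
  have deg': "degree (x ^ n) = 0" if "degree x = 0" for x :: U and n
    using that by (metis degree_power_eq mult_0_right power_0_left degree_0 degree_1 degree_power_le le_zero_eq mult_is_0)
  have e: "umonom a m n p q = UK ^ m * UM ^ n * UP ^ p * UH ^ q"
    unfolding umonom_def galilei_pow_K galilei_pow_const[OF deg(1)] galilei_pow_const[OF deg(2)]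
      galilei_pow_const[OF deg(3)]
    by (simp add: galilei_def umult_const_right deg' deg)
  have "UK ^ m = monom 1 m" by (simp add: UK_def monom_altdef)
  moreover have "UM ^ n = [:monom 1 n:]" by (simp add: UM_def monom_altdef poly_const_pow)
  moreover have "UP ^ p = [:[:[:fps_X ^ p:]:]:]" by (simp add: UP_def poly_const_pow)
  moreover have "UH ^ q = [:[:monom 1 q:]:]" by (simp add: UH_def monom_altdef poly_const_pow)
  ultimately show ?thesis unfolding e by (simp add: smult_monom mult_ac)
qed

lemma ucoeff_umonom:
  "ucoeff (umonom a m n p q) m' n' p' q' =
     (if m' = m \<and> n' = n \<and> p' = p \<and> q' = q then 1 else 0)"
  by (simp add: umonom_eq ucoeff_def)

lemma ucoeff_eqI: "(\<And>m n p q. ucoeff g m n p q = ucoeff h m n p q) \<Longrightarrow> g = h"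
  by (intro poly_eqI fps_ext) (simp add: ucoeff_def)


section \<open>The dual space A and the pairing\<close>

text \<open>
  The element \<open>e\<^sup>\<alpha>\<^sup>v e\<^sup>\<beta>\<^sup>\<mu> \<phi>\<close> is an infinite combination of ordered monomials in the directions of \<open>v\<close> and
  \<open>\<mu>\<close>. Accordingly \<open>f :: A\<close> stands for \<open>\<Sum>\<^sub>m\<^sub>n v\<^sup>m \<mu>\<^sup>n f\<^sub>m\<^sub>n(x,t)\<close>, with \<open>f\<^sub>m\<^sub>n(x,t)\<close> a (finite) linear combination of
  the monomials \<open>x\<^sup>p t\<^sup>q\<close>; the outer \<open>poly\<close> is for \<open>t\<close>, the inner one for \<open>x\<close>. No product on \<open>A\<close> is used.
\<close>

type_synonym xt = "complex poly poly"
type_synonym A = "nat \<Rightarrow> nat \<Rightarrow> xt"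

definition acoeff :: "A \<Rightarrow> nat \<Rightarrow> nat \<Rightarrow> nat \<Rightarrow> nat \<Rightarrow> complex" where
  "acoeff f m n p q = coeff (coeff (f m n) q) p"

definition ascale :: "complex \<Rightarrow> A \<Rightarrow> A" where
  "ascale c f = (\<lambda>m n. smult [:c:] (f m n))"

definition amonom :: "nat \<Rightarrow> nat \<Rightarrow> nat \<Rightarrow> nat \<Rightarrow> A" where
  "amonom m n p q = (\<lambda>m' n'. if m' = m \<and> n' = n then monom (monom 1 p) q else 0)"

text \<open>
  The bilinear pairing with \<open>\<langle>K\<^sup>m M\<^sup>n P\<^sup>p H\<^sup>q, v\<^sup>m\<^sup>' \<mu>\<^sup>n\<^sup>' x\<^sup>p\<^sup>' t\<^sup>q\<^sup>'\<rangle> = m! n! p! q! \<delta> \<delta> \<delta> \<delta>\<close>. Only finitely many summands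
  are nonzero.
\<close>

definition pairing :: "U \<Rightarrow> A \<Rightarrow> complex" where
  "pairing h f = Sum_any (\<lambda>(m, n, p, q).
     fact m * fact n * fact p * fact q * ucoeff h m n p q * acoeff f m n p q)"

lemma finite_pairing_support:
  "finite {(m, n, p, q). ucoeff h m n p q * acoeff f m n p q \<noteq> 0}"
proof (rule finite_subset)
  let ?B = "SIGMA m:{..degree h}. SIGMA n:{..degree (coeff h m)}.
      {(p, q). coeff (coeff (f m n) q) p \<noteq> 0}"
  have fin: "finite {(p, q). coeff (coeff r q) p \<noteq> 0}" for r :: xt
  proof (rule finite_subset)
    show "{(p, q). coeff (coeff r q) p \<noteq> 0}
        \<subseteq> (\<Union>q\<in>{..degree r}. {..degree (coeff r q)} \<times> {q})"
      using le_degree by (force intro!: le_degree)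
  qed auto
  show "finite ?B"
    by (intro finite_SigmaI fin) auto
  show "{(m, n, p, q). ucoeff h m n p q * acoeff f m n p q \<noteq> 0} \<subseteq> ?B"
    by (auto simp: ucoeff_def acoeff_def intro!: le_degree)
qed

lemma pairing_umonom:
  "pairing (umonom a m n p q) f = fact m * fact n * fact p * fact q * acoeff f m n p q"
proof -
  have "pairing (umonom a m n p q) f = Sum_any (\<lambda>x. if x = (m, n, p, q)
      then fact m * fact n * fact p * fact q * acoeff f m n p q else 0)"
    unfolding pairing_def by (intro arg_cong[of _ _ Sum_any] ext) (auto simp: ucoeff_umonom split: if_splits)
  then show ?thesis by simp
qed

lemma pairing_monomials:
  "pairing (umonom a m n p q) (amonom m' n' p' q') =
     (if m = m' \<and> n = n' \<and> p = p' \<and> q = q' then fact m * fact n * fact p * fact q else 0)"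
  by (simp add: pairing_umonom acoeff_def amonom_def)

lemma pairing_amonom:
  "pairing h (amonom m n p q) = fact m * fact n * fact p * fact q * ucoeff h m n p q"
proof -
  have "pairing h (amonom m n p q) = Sum_any (\<lambda>x. if x = (m, n, p, q)
      then fact m * fact n * fact p * fact q * ucoeff h m n p q else 0)"
    unfolding pairing_def
    by (intro arg_cong[of _ _ Sum_any] ext) (auto simp: acoeff_def amonom_def split: if_splits)
  then show ?thesis by simp
qed

lemma pairing_nondegenerate_A:
  assumes "\<And>h. pairing h f = pairing h g"
  shows "f = g"
proof -
  have "acoeff f m n p q = acoeff g m n p q" for m n p q
    using assms[of "umonom 0 m n p q"] by (simp add: pairing_umonom)
  then show ?thesis by (intro ext poly_eqI) (simp add: acoeff_def)
qed

lemma pairing_nondegenerate_U: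
  assumes "\<And>f. pairing g f = pairing h f"
  shows "g = h"
  using assms[of "amonom _ _ _ _"] by (intro ucoeff_eqI) (simp add: pairing_amonom)


section \<open>Actions and the induced representation\<close>

text \<open>
  \<open>f \<triangleleft> h\<^sub>1\<close> and \<open>h\<^sub>1 \<triangleright> f\<close>. Uniqueness of \<open>g\<close> is \<open>pairing_nondegenerate_A\<close>.
\<close>

definition ract :: "complex \<Rightarrow> A \<Rightarrow> U \<Rightarrow> A" where
  "ract a f h1 = (THE g. \<forall>h2. pairing h2 g = pairing (h1 \<otimes>\<^bsub>galilei a\<^esub> h2) f)"

definition lact :: "complex \<Rightarrow> U \<Rightarrow> A \<Rightarrow> A" where
  "lact a h1 f = (THE g. \<forall>h2. pairing h2 g = pairing (h2 \<otimes>\<^bsub>galilei a\<^esub> h1) f)"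

inductive_set generated_subalgebra :: "complex \<Rightarrow> U set \<Rightarrow> U set" for a S where
  gen: "x \<in> S \<Longrightarrow> x \<in> generated_subalgebra a S"
| one: "\<one>\<^bsub>galilei a\<^esub> \<in> generated_subalgebra a S"
| add: "x \<in> generated_subalgebra a S \<Longrightarrow> y \<in> generated_subalgebra a S
    \<Longrightarrow> x \<oplus>\<^bsub>galilei a\<^esub> y \<in> generated_subalgebra a S"
| mult: "x \<in> generated_subalgebra a S \<Longrightarrow> y \<in> generated_subalgebra a S
    \<Longrightarrow> x \<otimes>\<^bsub>galilei a\<^esub> y \<in> generated_subalgebra a S"
| scale: "x \<in> generated_subalgebra a S \<Longrightarrow> uscale c x \<in> generated_subalgebra a S"

text \<open>A character is a one-dimensional representation, i.e. a unital algebra homomorphism to the scalars.\<close>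

definition is_character :: "complex \<Rightarrow> U set \<Rightarrow> (U \<Rightarrow> complex) \<Rightarrow> bool" where
  "is_character a B \<chi> \<longleftrightarrow>
     \<chi> \<one>\<^bsub>galilei a\<^esub> = 1 \<and>
     (\<forall>x\<in>B. \<forall>y\<in>B. \<chi> (x \<oplus>\<^bsub>galilei a\<^esub> y) = \<chi> x + \<chi> y) \<and>
     (\<forall>x\<in>B. \<forall>y\<in>B. \<chi> (x \<otimes>\<^bsub>galilei a\<^esub> y) = \<chi> x * \<chi> y) \<and>
     (\<forall>c. \<forall>x\<in>B. \<chi> (uscale c x) = c * \<chi> x)"

definition carrier_space :: "complex \<Rightarrow> (U \<Rightarrow> complex) \<Rightarrow> A set" where
  "carrier_space a \<chi> = {f. ract a f UK = ascale (\<chi> UK) f \<and> ract a f UM = ascale (\<chi> UM) f}"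

lemma character_exists:
  fixes \<alpha> \<beta> :: complex
  shows "\<exists>\<chi>. is_character a (generated_subalgebra a {UM, UK}) \<chi> \<and>
    (\<forall>m n::nat. \<chi> (UK [^]\<^bsub>galilei a\<^esub> m \<otimes>\<^bsub>galilei a\<^esub> UM [^]\<^bsub>galilei a\<^esub> n) = \<alpha> ^ m * \<beta> ^ n)"
proof -
  define \<chi> where "\<chi> h = fps_nth (poly (poly (poly h [:[:fps_const \<alpha>:]:]) [:fps_const \<beta>:]) 0) 0" for h :: U
  have d1: "udelta a 1 = 0" using udelta_const[of a 1] by (simp add: uconst_def flip: one_pCons)
  have B: "udelta a x = 0" if "x \<in> generated_subalgebra a {UM, UK}" for x
    using that
    by induction (auto simp: udelta_generators galilei_def d1 udelta_add udelta_mult umult_delta_0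
        udelta_uscale)
  have m: "\<chi> (x * y) = \<chi> x * \<chi> y" for x y by (simp add: \<chi>_def)
  have one: "\<chi> 1 = 1" by (simp add: \<chi>_def)
  have c: "\<chi> (uconst c) = c" for c by (simp add: \<chi>_def uconst_def)
  have pw: "\<chi> (x ^ n) = \<chi> x ^ n" for x n by (induction n) (simp_all add: m one)
  have g: "\<chi> UK = \<alpha>" "\<chi> UM = \<beta>" by (simp_all add: \<chi>_def UK_def UM_def)
  have "is_character a (generated_subalgebra a {UM, UK}) \<chi>"
    unfolding is_character_def
    by (auto simp: galilei_def one uscale_def m c umult_delta_0 B) (simp add: \<chi>_def)
  moreover have "\<chi> (UK [^]\<^bsub>galilei a\<^esub> m \<otimes>\<^bsub>galilei a\<^esub> UM [^]\<^bsub>galilei a\<^esub> n) = \<alpha> ^ m * \<beta> ^ n" for m n :: nat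
  proof -
    have "degree UM = 0" by (simp add: UM_def)
    then have "UK [^]\<^bsub>galilei a\<^esub> m \<otimes>\<^bsub>galilei a\<^esub> UM [^]\<^bsub>galilei a\<^esub> n = UK ^ m * UM ^ n"
      unfolding galilei_pow_K galilei_pow_const[OF \<open>degree UM = 0\<close>]
      by (simp add: galilei_def umult_delta_0 udelta_pow_K)
    then show ?thesis by (simp add: m pw g)
  qed
  ultimately show ?thesis by blast
qed

text \<open>\<open>e\<^sup>\<alpha>\<^sup>v e\<^sup>\<beta>\<^sup>\<mu> \<phi>(x,t)\<close>, expanded in ordered monomials.\<close>

definition exp_elem :: "complex \<Rightarrow> complex \<Rightarrow> xt \<Rightarrow> A" where
  "exp_elem \<alpha> \<beta> \<phi> = (\<lambda>m n. smult [:\<alpha> ^ m / fact m * (\<beta> ^ n / fact n):] \<phi>)"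

text \<open>
  \<open>h \<turnstile> \<phi>\<close>: the action \<open>h \<triangleright> f\<close> on \<open>f = e\<^sup>\<alpha>\<^sup>v e\<^sup>\<beta>\<^sup>\<mu> \<phi>\<close>, written on \<open>\<phi>\<close> (which is determined by \<open>f\<close>, being
  its coefficient at \<open>v\<^sup>0 \<mu>\<^sup>0\<close>).
\<close>

definition induced_act :: "complex \<Rightarrow> complex \<Rightarrow> complex \<Rightarrow> U \<Rightarrow> xt \<Rightarrow> xt" where
  "induced_act a \<alpha> \<beta> h \<phi> = (THE \<psi>. lact a h (exp_elem \<alpha> \<beta> \<phi>) = exp_elem \<alpha> \<beta> \<psi>)"

definition xscale :: "complex \<Rightarrow> xt \<Rightarrow> xt" where "xscale c \<phi> = smult [:c:] \<phi>"
definition xbar :: "xt \<Rightarrow> xt" where "xbar = map_poly (pCons 0)"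
definition tbar :: "xt \<Rightarrow> xt" where "tbar = pCons 0"
definition dx :: "xt \<Rightarrow> xt" where "dx = map_poly pderiv"
definition dt :: "xt \<Rightarrow> xt" where "dt = pderiv"

text \<open>
  \<open>s(D) = \<Sum>\<^sub>k s\<^sub>k D\<^sup>k\<close> for a power series \<open>s\<close> and an operator \<open>D\<close> such that every \<open>\<phi>\<close> is annihilated
  by some power of \<open>D\<close>.
\<close>

definition series_op :: "complex fps \<Rightarrow> (xt \<Rightarrow> xt) \<Rightarrow> xt \<Rightarrow> xt" where
  "series_op s D \<phi> = Sum_any (\<lambda>k. xscale (fps_nth s k) ((D ^^ k) \<phi>))"

end

theory Submission
  imports Defs
begin

text \<open>
  Under the pairing, the operators on \<open>U\<close> have adjoints on \<open>A\<close>: multiplication by \<open>P\<close> and \<open>H\<close>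
  is adjoint to \<open>\<partial>/\<partial>x\<close> and \<open>\<partial>/\<partial>t\<close>, the derivations \<open>\<partial>/\<partial>P\<close> and \<open>\<partial>/\<partial>H\<close> to raising the exponent
  of \<open>x\<close> and \<open>t\<close>, and multiplication by \<open>K\<close> and \<open>M\<close> to \<open>\<partial>/\<partial>v\<close> and \<open>\<partial>/\<partial>\<mu>\<close>. Left multiplication by
  \<open>K\<close> and \<open>M\<close> needs no reordering, so equivariance is the pair of differential equations
  \<open>\<partial>f/\<partial>v = \<alpha> f\<close>, \<open>\<partial>f/\<partial>\<mu> = \<beta> f\<close>, with solutions \<open>e\<^sup>\<alpha>\<^sup>v e\<^sup>\<beta>\<^sup>\<mu> \<phi>\<close>. Right multiplication by \<open>M\<close>, \<open>P\<close>,
  \<open>H\<close> is commutative as well, while \<open>h K = K h - M \<partial>h/\<partial>P - (sinh(aP)/a) \<partial>h/\<partial>H\<close>; taking adjoints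
  term by term gives the action of \<open>K\<close>.
\<close>

section \<open>Adjoints with respect to the pairing\<close>

lemma Sum_any_reindex_inj:
  assumes "inj r" "\<And>y. y \<notin> range r \<Longrightarrow> F y = 0"
  shows "Sum_any F = Sum_any (\<lambda>x. F (r x))"
proof -
  have eq: "{y. F y \<noteq> 0} = r ` {x. F (r x) \<noteq> 0}"
  proof (intro equalityI subsetI)
    fix y assume "y \<in> {y. F y \<noteq> 0}"
    then have "F y \<noteq> 0" by simp
    with assms(2) obtain x where "y = r x" by (metis rangeE)
    with \<open>F y \<noteq> 0\<close> show "y \<in> r ` {x. F (r x) \<noteq> 0}" by simp
  qed auto
  have inj: "inj_on r {x. F (r x) \<noteq> 0}"
    using assms(1) by (rule inj_on_subset) simp
  show ?thesis
    by (simp only: Sum_any.expand_set eq sum.reindex[OF inj] comp_def)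
qed

lemma acoeff_add: "acoeff (f + g) m n p q = acoeff f m n p q + acoeff g m n p q"
  by (simp add: acoeff_def)

lemma acoeff_ascale: "acoeff (ascale c f) m n p q = c * acoeff f m n p q"
  by (simp add: acoeff_def ascale_def)

lemma ucoeff_add: "ucoeff (g + h) m n p q = ucoeff g m n p q + ucoeff h m n p q"
  by (simp add: ucoeff_def)

lemma ucoeff_uscale: "ucoeff (uscale c h) m n p q = c * ucoeff h m n p q"
  by (simp add: ucoeff_def uscale_def uconst_def)

lemma finite_pairing_support':
  "finite {x. (case x of (m, n, p, q) \<Rightarrow>
     fact m * fact n * fact p * fact q * ucoeff h m n p q * acoeff f m n p q) \<noteq> (0::complex)}"
  by (rule finite_subset[OF _ finite_pairing_support[of h f]]) auto

lemma pairing_add_left: "pairing (g + h) f = pairing g f + pairing h f"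
  unfolding pairing_def
  by (subst Sum_any.distrib[symmetric, OF finite_pairing_support' finite_pairing_support'])
     (auto intro!: arg_cong[of _ _ Sum_any] simp: ucoeff_add algebra_simps)

lemma pairing_add_right: "pairing h (f + g) = pairing h f + pairing h g"
  unfolding pairing_def
  by (subst Sum_any.distrib[symmetric, OF finite_pairing_support' finite_pairing_support'])
     (auto intro!: arg_cong[of _ _ Sum_any] simp: acoeff_add algebra_simps)

lemma pairing_uscale: "pairing (uscale c h) f = c * pairing h f"
  unfolding pairing_def
  by (subst Sum_any_right_distrib[OF finite_pairing_support'])
     (auto intro!: arg_cong[of _ _ Sum_any] simp: ucoeff_uscale algebra_simps)

lemma pairing_ascale: "pairing h (ascale c f) = c * pairing h f"
  unfolding pairing_def
  by (subst Sum_any_right_distrib[OF finite_pairing_support'])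
     (auto intro!: arg_cong[of _ _ Sum_any] simp: acoeff_ascale algebra_simps)

section \<open>Coefficients of shifted and differentiated elements of U and A\<close>

lemma ucoeff_UK_mult:
  "ucoeff (UK * h) m n p q = (case m of 0 \<Rightarrow> 0 | Suc m \<Rightarrow> ucoeff h m n p q)"
  by (simp add: ucoeff_def UK_def coeff_pCons split: nat.split)

lemma ucoeff_UM_mult:
  "ucoeff (UM * h) m n p q = (case n of 0 \<Rightarrow> 0 | Suc n \<Rightarrow> ucoeff h m n p q)"
  by (simp add: ucoeff_def UM_def coeff_pCons split: nat.split)

lemma ucoeff_UH_mult:
  "ucoeff (UH * h) m n p q = (case q of 0 \<Rightarrow> 0 | Suc q \<Rightarrow> ucoeff h m n p q)"
  by (simp add: ucoeff_def UH_def coeff_pCons split: nat.split)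

lemma ucoeff_UP_mult:
  "ucoeff (UP * h) m n p q = (case p of 0 \<Rightarrow> 0 | Suc p \<Rightarrow> ucoeff h m n p q)"
  by (simp add: ucoeff_def UP_def split: nat.split)

lemma ucoeff_dP: "ucoeff (dP h) m n p q = of_nat (Suc p) * ucoeff h m n (Suc p) q"
  by (simp add: ucoeff_def dP_def coeff_map_poly)

lemma ucoeff_dH: "ucoeff (dH h) m n p q = of_nat (Suc q) * ucoeff h m n p (Suc q)"
  by (simp add: ucoeff_def dH_def coeff_map_poly coeff_pderiv flip: fps_of_nat)

lemma acoeff_dx: "acoeff (\<lambda>m n. dx (f m n)) m n p q = of_nat (Suc p) * acoeff f m n (Suc p) q"
  by (simp add: acoeff_def dx_def coeff_map_poly coeff_pderiv)

lemma acoeff_dt: "acoeff (\<lambda>m n. dt (f m n)) m n p q = of_nat (Suc q) * acoeff f m n p (Suc q)"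
  by (simp add: acoeff_def dt_def coeff_pderiv of_nat_poly)

lemma acoeff_xbar:
  "acoeff (\<lambda>m n. xbar (f m n)) m n p q = (case p of 0 \<Rightarrow> 0 | Suc p \<Rightarrow> acoeff f m n p q)"
  by (simp add: acoeff_def xbar_def coeff_map_poly coeff_pCons split: nat.split)

lemma acoeff_tbar:
  "acoeff (\<lambda>m n. tbar (f m n)) m n p q = (case q of 0 \<Rightarrow> 0 | Suc q \<Rightarrow> acoeff f m n p q)"
  by (simp add: acoeff_def tbar_def coeff_pCons split: nat.split)

text \<open>The factor K raises m, so the terms with m = 0 vanish and the sum can be shifted; (m+1)!
  = (m+1) m! then leaves the factor of the formal derivative in v. The next three lemmas use the
  same shift for M, P and H.\<close>

lemma pairing_UK_mult:
  "pairing (UK * h) f = pairing h (\<lambda>m n. smult [:of_nat (Suc m):] (f (Suc m) n))"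
  unfolding pairing_def
  by (subst Sum_any_reindex_inj[where r = "\<lambda>(m, n, p, q). (Suc m, n, p, q)"])
     (auto intro!: injI arg_cong[of _ _ Sum_any] simp: ucoeff_UK_mult acoeff_def image_iff
       split: nat.splits)

lemma pairing_UM_mult:
  "pairing (UM * h) f = pairing h (\<lambda>m n. smult [:of_nat (Suc n):] (f m (Suc n)))"
  unfolding pairing_def
  by (subst Sum_any_reindex_inj[where r = "\<lambda>(m, n, p, q). (m, Suc n, p, q)"])
     (auto intro!: injI arg_cong[of _ _ Sum_any] simp: ucoeff_UM_mult acoeff_def image_iff
       split: nat.splits)

lemma pairing_UP_mult: "pairing (UP * h) f = pairing h (\<lambda>m n. dx (f m n))"
  unfolding pairing_def
  by (subst Sum_any_reindex_inj[where r = "\<lambda>(m, n, p, q). (m, n, Suc p, q)"])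
     (auto intro!: injI arg_cong[of _ _ Sum_any] simp: ucoeff_UP_mult acoeff_dx image_iff
       split: nat.splits)

lemma pairing_UH_mult: "pairing (UH * h) f = pairing h (\<lambda>m n. dt (f m n))"
  unfolding pairing_def
  by (subst Sum_any_reindex_inj[where r = "\<lambda>(m, n, p, q). (m, n, p, Suc q)"])
     (auto intro!: injI arg_cong[of _ _ Sum_any] simp: ucoeff_UH_mult acoeff_dt image_iff
       split: nat.splits)

lemma pairing_dP: "pairing (dP h) f = pairing h (\<lambda>m n. xbar (f m n))"
  unfolding pairing_def
  \<comment> \<open>The raising operator now sits on the A side, so the right-hand sum is the one
    shifted; its terms with p = 0 vanish.\<close>
  by (subst (2) Sum_any_reindex_inj[where r = "\<lambda>(m, n, p, q). (m, n, Suc p, q)"])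
     (auto intro!: injI arg_cong[of _ _ Sum_any] simp: ucoeff_dP acoeff_xbar image_iff
       split: nat.splits)

lemma pairing_dH: "pairing (dH h) f = pairing h (\<lambda>m n. tbar (f m n))"
  unfolding pairing_def
  by (subst (2) Sum_any_reindex_inj[where r = "\<lambda>(m, n, p, q). (m, n, p, Suc q)"])
     (auto intro!: injI arg_cong[of _ _ Sum_any] simp: ucoeff_dH acoeff_tbar image_iff
       split: nat.splits)


section \<open>Pairing with the equivariant elements\<close>

lemma exp_elem_add: "exp_elem \<alpha> \<beta> (\<phi> + \<psi>) = exp_elem \<alpha> \<beta> \<phi> + exp_elem \<alpha> \<beta> \<psi>"
  by (intro ext) (simp add: exp_elem_def smult_add_right)

lemma exp_elem_xscale: "exp_elem \<alpha> \<beta> (xscale c \<phi>) = ascale c (exp_elem \<alpha> \<beta> \<phi>)"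
  by (intro ext) (simp add: exp_elem_def xscale_def ascale_def mult_ac)

lemma exp_elem_apply_0: "exp_elem \<alpha> \<beta> \<phi> 0 0 = \<phi>"
  by (simp add: exp_elem_def flip: one_pCons)

lemma exp_elem_inject: "exp_elem \<alpha> \<beta> \<phi> = exp_elem \<alpha> \<beta> \<psi> \<longleftrightarrow> \<phi> = \<psi>"
  by (metis exp_elem_apply_0)

text \<open>The exponentials are eigenvectors of the formal derivatives in v and \<mu>.\<close>

lemma shift_exp_elem:
  "(\<lambda>m n. smult [:of_nat (Suc m):] (exp_elem \<alpha> \<beta> \<phi> (Suc m) n)) = ascale \<alpha> (exp_elem \<alpha> \<beta> \<phi>)"
  "(\<lambda>m n. smult [:of_nat (Suc n):] (exp_elem \<alpha> \<beta> \<phi> m (Suc n))) = ascale \<beta> (exp_elem \<alpha> \<beta> \<phi>)"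
  by (intro ext; simp add: exp_elem_def ascale_def divide_simps mult_ac del: of_nat_Suc)+

lemma operators_exp_elem:
  "(\<lambda>m n. dx (exp_elem \<alpha> \<beta> \<phi> m n)) = exp_elem \<alpha> \<beta> (dx \<phi>)"
  "(\<lambda>m n. dt (exp_elem \<alpha> \<beta> \<phi> m n)) = exp_elem \<alpha> \<beta> (dt \<phi>)"
  "(\<lambda>m n. xbar (exp_elem \<alpha> \<beta> \<phi> m n)) = exp_elem \<alpha> \<beta> (xbar \<phi>)"
  "(\<lambda>m n. tbar (exp_elem \<alpha> \<beta> \<phi> m n)) = exp_elem \<alpha> \<beta> (tbar \<phi>)"
  by (intro ext poly_eqI;
      simp add: exp_elem_def dx_def dt_def xbar_def tbar_def coeff_map_poly coeff_pderiv coeff_pCons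
        of_nat_poly pderiv_smult split: nat.split)+

text \<open>Restricting the pairing to exponential elements lets every adjoint be written on \<phi>
  alone, with K and M becoming scalars.\<close>

definition exp_pairing :: "complex \<Rightarrow> complex \<Rightarrow> U \<Rightarrow> xt \<Rightarrow> complex" where
  "exp_pairing \<alpha> \<beta> h \<phi> = pairing h (exp_elem \<alpha> \<beta> \<phi>)"

context
  fixes \<alpha> \<beta> :: complex
begin

abbreviation Q :: "U \<Rightarrow> xt \<Rightarrow> complex" where "Q \<equiv> exp_pairing \<alpha> \<beta>"

lemma exp_pairing_add:
  "Q (g + h) \<phi> = Q g \<phi> + Q h \<phi>" "Q h (\<phi> + \<psi>) = Q h \<phi> + Q h \<psi>"
  by (simp_all add: exp_pairing_def pairing_add_left pairing_add_right exp_elem_add)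

lemma exp_pairing_scale:
  "Q (uscale c h) \<phi> = c * Q h \<phi>" "Q h (xscale c \<phi>) = c * Q h \<phi>"
  by (simp_all add: exp_pairing_def pairing_uscale pairing_ascale exp_elem_xscale)

lemma exp_pairing_0: "Q 0 \<phi> = 0" "Q h 0 = 0"
  using exp_pairing_add(1)[of 0 0 \<phi>] exp_pairing_add(2)[of h 0 0] by simp_all

lemma exp_pairing_diff:
  "Q (g - h) \<phi> = Q g \<phi> - Q h \<phi>" "Q h (\<phi> - \<psi>) = Q h \<phi> - Q h \<psi>"
  using exp_pairing_add(1)[of "g - h" h \<phi>] exp_pairing_add(2)[of h "\<phi> - \<psi>" \<psi>] by simp_all

lemma exp_pairing_sum:
  "Q (sum F I) \<phi> = (\<Sum>i\<in>I. Q (F i) \<phi>)" "Q h (sum G I) = (\<Sum>i\<in>I. Q h (G i))"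
  by (induction I rule: infinite_finite_induct) (simp_all add: exp_pairing_0 exp_pairing_add)

lemma exp_pairing_adjoint:
  "Q (UK * h) \<phi> = \<alpha> * Q h \<phi>"
  "Q (UM * h) \<phi> = \<beta> * Q h \<phi>"
  "Q (UP * h) \<phi> = Q h (dx \<phi>)"
  "Q (UH * h) \<phi> = Q h (dt \<phi>)"
  "Q (dP h) \<phi> = Q h (xbar \<phi>)"
  "Q (dH h) \<phi> = Q h (tbar \<phi>)"
  by (simp_all add: exp_pairing_def pairing_UK_mult pairing_UM_mult pairing_UP_mult pairing_UH_mult
      pairing_dP pairing_dH operators_exp_elem shift_exp_elem pairing_ascale del: of_nat_Suc)

lemma exp_pairing_UP_power: "Q (UP ^ k * h) \<phi> = Q h ((dx ^^ k) \<phi>)"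
  \<comment> \<open>Moving one factor \<open>UP\<close> across replaces \<phi> by
    \<open>dx \<phi>\<close>, hence the generalisation over \<phi>.\<close>
  by (induction k arbitrary: \<phi>)
     (simp_all add: exp_pairing_adjoint mult.assoc funpow_Suc_right del: funpow.simps(2))

lemma dx_nilpotent: "\<exists>N. \<forall>k\<ge>N. (dx ^^ k) \<phi> = 0"
proof -
  have c: "coeff ((dx ^^ k) \<phi>) q = (pderiv ^^ k) (coeff \<phi> q)" for k q
    by (induction k) (simp_all add: dx_def coeff_map_poly)
  \<comment> \<open>N exceeds the x-degree of each of the finitely many coefficients of powers of t;
    the \<open>Suc\<close> also covers zero coefficients, whose degree is 0.\<close>
  define N where "N = Suc (Max ((\<lambda>q. degree (coeff \<phi> q)) ` {..degree \<phi>}))"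
  have "degree (coeff \<phi> q) < N" for q
  proof (cases "q \<le> degree \<phi>")
    case True
    then show ?thesis unfolding N_def by (simp add: less_Suc_eq_le)
  next
    case False
    then show ?thesis by (simp add: coeff_eq_0 N_def)
  qed
  then have "(dx ^^ k) \<phi> = 0" if "k \<ge> N" for k
    using that
    by (intro poly_eqI)
       (auto simp: c coeff_higher_pderiv intro!: coeff_eq_0 intro: less_le_trans trans_le_add2)
  then show ?thesis by blast
qed

text \<open>
  A power series in \<open>P\<close> is an infinite sum, over which the pairing is not a priori additive: split it
  as a polynomial plus \<open>P\<^sup>N\<close> times a remainder, where the remainder drops out because \<open>\<partial>\<^sub>x\<^sup>N \<phi> = 0\<close>.
\<close>

lemma exp_pairing_series: "Q ([:[:[:s:]:]:] * h) \<phi> = Q h (series_op s dx \<phi>)"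
proof -
  obtain N where N: "(dx ^^ k) \<phi> = 0" if "k \<ge> N" for k
    using dx_nilpotent by blast
  have UP: "UP ^ k = [:[:[:fps_X ^ k:]:]:]" for k
    by (simp add: UP_def poly_const_pow)
  have cut: "fps_cutoff N s = (\<Sum>k<N. fps_const (fps_nth s k) * fps_X ^ k)"
    by (rule fps_ext) (simp add: fps_sum_nth if_distrib cong: if_cong)
  have lift: "(\<Sum>i\<in>I. [:[:[:F i:]:]:]) = [:[:[:sum F I:]:]:]" for F :: "nat \<Rightarrow> complex fps" and I
    by (induction I rule: infinite_finite_induct) simp_all
  have "[:[:[:s:]:]:] = (\<Sum>k<N. uscale (fps_nth s k) (UP ^ k)) + UP ^ N * [:[:[:fps_shift N s:]:]:]"
  proof -
    have "[:[:[:s:]:]:] = [:[:[:fps_cutoff N s:]:]:] + [:[:[:fps_X ^ N * fps_shift N s:]:]:]"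
      using fps_shift_cutoff'[of N s] by (simp add: add.commute)
    also have "[:[:[:fps_cutoff N s:]:]:] = (\<Sum>k<N. uscale (fps_nth s k) (UP ^ k))"
      unfolding cut lift[symmetric] by (simp add: uscale_def uconst_def UP mult.commute)
    also have "[:[:[:fps_X ^ N * fps_shift N s:]:]:] = UP ^ N * [:[:[:fps_shift N s:]:]:]"
      by (simp add: UP)
    finally show ?thesis .
  qed
  then have "Q ([:[:[:s:]:]:] * h) \<phi> = (\<Sum>k<N. Q (uscale (fps_nth s k) (UP ^ k * h)) \<phi>)
      + Q (UP ^ N * ([:[:[:fps_shift N s:]:]:] * h)) \<phi>"
    by (simp only: distrib_right sum_distrib_right uscale_mult_left exp_pairing_add exp_pairing_sum
        mult.assoc)
  also have "\<dots> = Q h (\<Sum>k<N. xscale (fps_nth s k) ((dx ^^ k) \<phi>))"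
    by (simp only: exp_pairing_sum exp_pairing_scale exp_pairing_UP_power N[OF order_refl]
        exp_pairing_0 add_0_right)
  \<comment> \<open>All summands with k \<ge> N vanish, so the truncated sum is independent of the
    choice of N.\<close>
  also have "(\<Sum>k<N. xscale (fps_nth s k) ((dx ^^ k) \<phi>)) = series_op s dx \<phi>"
    unfolding series_op_def
  proof (rule Sum_any.expand_superset[symmetric])
    have "xscale (fps_nth s k) ((dx ^^ k) \<phi>) = 0" if "k \<ge> N" for k
      by (simp only: N[OF that] xscale_def smult_0_right)
    then show "{k. xscale (fps_nth s k) ((dx ^^ k) \<phi>) \<noteq> 0} \<subseteq> {..<N}"
      by (metis (mono_tags, lifting) lessThan_iff mem_Collect_eq not_le subsetI)
  qed simp
  finally show ?thesis .
qed

end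


section \<open>The actions\<close>

text \<open>Nondegeneracy of the pairing gives the uniqueness required by \<open>THE\<close>, so
  exhibiting one adjoint suffices; likewise for \<open>lact\<close> below.\<close>

lemma ract_eqI:
  assumes "\<And>h. pairing h g = pairing (umult a h1 h) f"
  shows "ract a f h1 = g"
  unfolding ract_def
  by (rule the_equality) (auto simp: galilei_def assms intro: pairing_nondegenerate_A)

lemma lact_eqI:
  assumes "\<And>h. pairing h g = pairing (umult a h h1) f"
  shows "lact a h1 f = g"
  unfolding lact_def
  by (rule the_equality) (auto simp: galilei_def assms intro: pairing_nondegenerate_A)

text \<open>Since \<open>udelta\<close> kills K, a left factor K multiplies as in the commutative
  product; the same holds for M.\<close>

lemma ract_UK: "ract a f UK = (\<lambda>m n. smult [:of_nat (Suc m):] (f (Suc m) n))"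
  by (rule ract_eqI) (simp add: umult_delta_0 udelta_generators pairing_UK_mult)

lemma ract_UM: "ract a f UM = (\<lambda>m n. smult [:of_nat (Suc n):] (f m (Suc n)))"
  by (rule ract_eqI) (simp add: umult_delta_0 udelta_generators pairing_UM_mult)

lemma equivariant_iff:
  "ract a f UK = ascale \<alpha> f \<and> ract a f UM = ascale \<beta> f \<longleftrightarrow> (\<exists>\<phi>. f = exp_elem \<alpha> \<beta> \<phi>)"
proof
  assume f: "ract a f UK = ascale \<alpha> f \<and> ract a f UM = ascale \<beta> f"
  \<comment> \<open>Both equivariance conditions have this shape coefficientwise; dividing by the
    nonzero \<open>Suc k\<close> turns them into recursions.\<close>
  have div: "x = smult [:c / of_nat (Suc k):] y"
    if eq: "smult [:of_nat (Suc k):] x = smult [:c:] y" for x y :: xt and c k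
  proof -
    have "x = smult [:1 / of_nat (Suc k):] (smult [:of_nat (Suc k):] x)"
      by (simp del: of_nat_Suc flip: one_pCons)
    also have "\<dots> = smult [:c / of_nat (Suc k):] y"
      unfolding eq by simp
    finally show ?thesis .
  qed
  have K: "f (Suc m) n = smult [:\<alpha> / of_nat (Suc m):] (f m n)" for m n
    by (rule div) (rule fun_cong[OF fun_cong[OF conjunct1[OF f, unfolded ract_UK ascale_def]]])
  have M: "f m (Suc n) = smult [:\<beta> / of_nat (Suc n):] (f m n)" for m n
    by (rule div) (rule fun_cong[OF fun_cong[OF conjunct2[OF f, unfolded ract_UM ascale_def]]])
  \<comment> \<open>Solve along \<mu> at m = 0 first, then along v; the free datum
    \<open>f 0 0\<close> is the required \<phi>.\<close>
  have f0: "f 0 n = smult [:\<beta> ^ n / fact n:] (f 0 0)" for n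
  proof (induction n)
    case 0
    show ?case by (simp flip: one_pCons)
  next
    case (Suc n)
    show ?case unfolding M Suc by (simp add: mult.commute del: of_nat_Suc)
  qed
  have "f m n = exp_elem \<alpha> \<beta> (f 0 0) m n" for m n
  proof (induction m)
    case 0
    show ?case by (subst f0) (simp add: exp_elem_def)
  next
    case (Suc m)
    show ?case unfolding K Suc by (simp add: exp_elem_def mult_ac del: of_nat_Suc)
  qed
  then show "\<exists>\<phi>. f = exp_elem \<alpha> \<beta> \<phi>" by blast
next
  assume "\<exists>\<phi>. f = exp_elem \<alpha> \<beta> \<phi>"
  then show "ract a f UK = ascale \<alpha> f \<and> ract a f UM = ascale \<beta> f"
    by (auto simp: ract_UK ract_UM shift_exp_elem simp del: of_nat_Suc)
qed

section \<open>The induced action of the generators\<close>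

lemma induced_act_eqI:
  assumes "\<And>h. exp_pairing \<alpha> \<beta> h \<psi> = exp_pairing \<alpha> \<beta> (umult a h g) \<phi>"
  shows "induced_act a \<alpha> \<beta> g \<phi> = \<psi>"
proof -
  have "lact a g (exp_elem \<alpha> \<beta> \<phi>) = exp_elem \<alpha> \<beta> \<psi>"
    using assms by (intro lact_eqI) (simp add: exp_pairing_def)
  then show ?thesis
    unfolding induced_act_def by (simp add: exp_elem_inject)
qed

lemma induced_act_UK:
  "induced_act a \<alpha> \<beta> UK \<phi> =
     xscale \<alpha> \<phi> - xscale \<beta> (xbar \<phi>) - tbar (series_op (sinh_series a) dx \<phi>)"
proof (rule induced_act_eqI)
  fix h
  have "umult a h UK = UK * h - UM * dP h - U_sinh a * dH h"
    by (simp add: umult_K_right udelta_def)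
  then show "exp_pairing \<alpha> \<beta> h
      (xscale \<alpha> \<phi> - xscale \<beta> (xbar \<phi>) - tbar (series_op (sinh_series a) dx \<phi>)) =
      exp_pairing \<alpha> \<beta> (umult a h UK) \<phi>"
    \<comment> \<open>The outer factor is moved across first: the sinh series acts on \<phi> before
      \<open>dH\<close> contributes \<open>tbar\<close>, which fixes the operator order.\<close>
    by (simp only: exp_pairing_diff exp_pairing_adjoint exp_pairing_scale U_sinh_def
        exp_pairing_series)
qed

text \<open>M, P and H have degree 0 in K, so right multiplication by them produces no reordering
  terms.\<close>

lemma induced_act_others:
  "induced_act a \<alpha> \<beta> UM \<phi> = xscale \<beta> \<phi>"
  "induced_act a \<alpha> \<beta> UP \<phi> = dx \<phi>"
  "induced_act a \<alpha> \<beta> UH \<phi> = dt \<phi>"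
proof -
  have deg: "degree UM = 0" "degree UP = 0" "degree UH = 0"
    by (simp_all add: UM_def UP_def UH_def)
  show "induced_act a \<alpha> \<beta> UM \<phi> = xscale \<beta> \<phi>" "induced_act a \<alpha> \<beta> UP \<phi> = dx \<phi>"
    "induced_act a \<alpha> \<beta> UH \<phi> = dt \<phi>"
    by (rule induced_act_eqI; simp add: umult_const_right deg mult.commute[of _ UM]
        mult.commute[of _ UP] mult.commute[of _ UH] exp_pairing_adjoint exp_pairing_scale)+
qed

section \<open>The subspace spanned by the monomials in x and t, and its isomorphism with the
  carrier space\<close>

definition xt_elem :: "xt \<Rightarrow> A" where
  "xt_elem \<phi> = (\<lambda>m n. if m = 0 \<and> n = 0 then \<phi> else 0)"

lemma vector_space_ascale: "vector_space ascale"
  by unfold_locales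
     (auto simp: ascale_def fun_eq_iff smult_add_right mult.commute one_pCons[symmetric]
       simp flip: smult_add_left)

lemma span_xt_monomials: "module.span ascale {amonom 0 0 p q | p q. True} = range xt_elem"
proof
  interpret vector_space ascale by (rule vector_space_ascale)
  have add: "xt_elem (\<phi> + \<psi>) = xt_elem \<phi> + xt_elem \<psi>" for \<phi> \<psi>
    by (auto simp: xt_elem_def fun_eq_iff)
  have sc: "xt_elem (smult [:c:] \<phi>) = ascale c (xt_elem \<phi>)" for c \<phi>
    by (auto simp: xt_elem_def fun_eq_iff ascale_def)
  have z: "xt_elem 0 = 0"
    by (auto simp: xt_elem_def fun_eq_iff)
  have sum: "xt_elem (sum F I) = (\<Sum>i\<in>I. xt_elem (F i))" for F :: "nat \<Rightarrow> xt" and I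
    by (induction I rule: infinite_finite_induct) (simp_all add: z add)
  have mon: "amonom 0 0 p q = xt_elem (monom (monom 1 p) q)" for p q
    by (auto simp: amonom_def xt_elem_def fun_eq_iff)
  show "span {amonom 0 0 p q | p q. True} \<subseteq> range xt_elem"
  proof (rule span_minimal)
    show "subspace (range xt_elem)"
      unfolding subspace_def by (auto simp flip: z add sc)
  qed (auto simp: mon)
  show "range xt_elem \<subseteq> span {amonom 0 0 p q | p q. True}"
  proof clarify
    fix \<phi> :: xt
    have "\<phi> = (\<Sum>q\<le>degree \<phi>. \<Sum>p\<le>degree (coeff \<phi> q).
        smult [:coeff (coeff \<phi> q) p:] (monom (monom 1 p) q))"
    proof -
      \<comment> \<open>Collapsing the sum over powers of x leaves the usual expansion of \<phi> in
        powers of t.\<close>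
      have inner: "(\<Sum>p\<le>degree r. smult [:coeff r p:] (monom (monom 1 p) q)) = monom r q"
        for r :: "complex poly" and q
      proof -
        have "monom (\<Sum>p\<le>n. monom (coeff r p) p) q
            = (\<Sum>p\<le>n. smult [:coeff r p:] (monom (monom 1 p) q))" for n
          by (induction n) (simp_all add: smult_monom monom_0 flip: add_monom)
        then show ?thesis by (metis poly_as_sum_of_monoms)
      qed
      show ?thesis unfolding inner poly_as_sum_of_monoms ..
    qed
    then have "xt_elem \<phi> = (\<Sum>q\<le>degree \<phi>. \<Sum>p\<le>degree (coeff \<phi> q).
        ascale (coeff (coeff \<phi> q) p) (amonom 0 0 p q))"
      by (simp only: mon flip: sc sum)
    also have "\<dots> \<in> span {amonom 0 0 p q | p q. True}"
      by (intro span_sum span_scale span_base) blast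
    finally show "xt_elem \<phi> \<in> span {amonom 0 0 p q | p q. True}" .
  qed
qed

lemma linear_restrict_0_0: "Vector_Spaces.linear ascale ascale (\<lambda>f. xt_elem (f 0 0))"
  unfolding Vector_Spaces.linear_iff
    by (auto simp: xt_elem_def ascale_def fun_eq_iff vector_space_ascale)

theorem theorem4p1:
  fixes a \<alpha> \<beta> :: complex and \<chi> :: "U \<Rightarrow> complex"
  assumes "a \<noteq> 0"
    and "is_character a (generated_subalgebra a {UM, UK}) \<chi>"
    and "\<forall>m n::nat. \<chi> (UK [^]\<^bsub>galilei a\<^esub> m \<otimes>\<^bsub>galilei a\<^esub> UM [^]\<^bsub>galilei a\<^esub> n) = \<alpha> ^ m * \<beta> ^ n"
  shows "carrier_space a \<chi> = {exp_elem \<alpha> \<beta> \<phi> | \<phi>. True} \<and>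
    (\<exists>T. Vector_Spaces.linear ascale ascale T \<and>
         bij_betw T (carrier_space a \<chi>) (module.span ascale {amonom 0 0 p q | p q. True})) \<and>
    (\<forall>\<phi>.
       induced_act a \<alpha> \<beta> UK \<phi> =
         xscale \<alpha> \<phi> - xscale \<beta> (xbar \<phi>) - tbar (series_op (sinh_series a) dx \<phi>) \<and>
       induced_act a \<alpha> \<beta> UM \<phi> = xscale \<beta> \<phi> \<and>
       induced_act a \<alpha> \<beta> UP \<phi> = dx \<phi> \<and>
       induced_act a \<alpha> \<beta> UH \<phi> = dt \<phi>)"
\<comment> \<open>The isomorphism reads off the component at v^0 \<mu>^0, which for
  \<open>exp_elem \<alpha> \<beta> \<phi>\<close> is \<phi> itself.\<close>
proof (intro conjI exI[of _ "\<lambda>f. xt_elem (f 0 0)"] allI)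
  have deg: "degree UM = 0" by (simp add: UM_def)
  note gen = galilei_pow_K galilei_pow_const[OF deg]
  \<comment> \<open>The values on the generators are the cases (1,0) and (0,1) of the formula on
    monomials.\<close>
  have chi: "\<chi> UK = \<alpha>" "\<chi> UM = \<beta>"
    using assms(3)[rule_format, of 1 0] assms(3)[rule_format, of 0 1] unfolding gen
    by (simp_all add: galilei_def umult_const_right umult_delta_0 udelta_pow_K[of a 0, simplified])
  show car: "carrier_space a \<chi> = {exp_elem \<alpha> \<beta> \<phi> | \<phi>. True}"
    unfolding carrier_space_def chi equivariant_iff by blast
  show "bij_betw (\<lambda>f. xt_elem (f 0 0)) (carrier_space a \<chi>)
      (module.span ascale {amonom 0 0 p q | p q. True})"
    unfolding span_xt_monomials car
  proof (rule bij_betw_imageI)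
    show "inj_on (\<lambda>f. xt_elem (f 0 0)) {exp_elem \<alpha> \<beta> \<phi> | \<phi>. True}"
      by (auto intro!: inj_onI simp: exp_elem_apply_0) (metis xt_elem_def)
    show "(\<lambda>f. xt_elem (f 0 0)) ` {exp_elem \<alpha> \<beta> \<phi> | \<phi>. True} = range xt_elem"
      by (auto simp: exp_elem_apply_0 image_iff) (metis exp_elem_apply_0)
  qed
qed (simp_all only: linear_restrict_0_0 induced_act_UK induced_act_others)

end
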